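(* Let $n$ be a positive integer, $G=\mathbb{Z}/n\mathbb{Z}$, $N=\lfloor n/2\rfloor$, and let $U\in \mathbf{M}_{N+1}$ be the discrete cosine transform matrix $$[U]_{j+1,k+1}=\frac{\sqrt{|X_j||X_k|}}{\sqrt n}\cos\Big(\frac{2\pi jk}{n}\Big),\qquad 0\le j,k\le N.$$ For $0\le i\le N$ define $T_i\in\mathbf{M}_{N+1}$ by $$[T_i]_{j+1,k+1}=\frac{c_{ijk}\sqrt{|X_k|}}{\sqrt{|X_j|}},\qquad 0\le j,k\le N.$$ Then $T_0,T_1,\ldots,T_N$ form a basis for the algebra $\mathcal{A}$ of all matrices in $\mathbf{M}_{N+1}$ that are diagonalized by $U$. They are real, symmetric, and satisfy $T_i=UD_iU^*$, in which $$D_i=|X_i|\,\operatorname{diag}\big(1,\cos\tfrac{2\pi i}{n},\cos\tfrac{4\pi i}{n},\ldots,\cos\tfrac{2\pi Ni}{n}\big)\in\mathbf{M}_{N+1}.$$ Moreover, $T_0=I$, and $T_i$ generates $\mathcal{A}$ if and only if $i$ is relatively prime to $n$. The most general matrix $T\in\mathbf{M}_{N+1}$ diagonalized by $U$ is given, for $1\le j,k\le N+1$, by $$[T]_{j,k}=\begin{cases} t_{\min(n-|k-j|,\,|k-j|)}+t_{\min(n-k-j+2,\,k+j-2)} & \text{for } 1<j,k<\frac n2+1,\\[6pt] |X_{j-1}|^{1/2}|X_{k-1}|^{1/2}\,t_{\max(j-1,k-1)} & \text{for } j=1\text{ or }k=1,\\[6pt] |X_{\frac n2+1-j}|^{1/2}|X_{\frac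 n2+1-k}|^{1/2}\,t_{\max(\frac n2+1-j,\frac n2+1-k)} & \text{for } j=\frac n2+1\text{ or }k=\frac n2+1,\end{cases}$$ in which $t_0,t_1,\ldots,t_N\in\mathbb{C}$ are free parameters (the last case only occurs if $n$ is even).
   Context: $\mathbf{M}_{m}$ denotes the set of $m\times m$ complex matrices. For $j=0,1,\ldots,N$, the set $X_j\subseteq G=\mathbb{Z}/n\mathbb{Z}$ is the orbit of $j$ under $x\mapsto \pm x$: $X_j=\{j,-j\}$ if $2j\ne 0$ in $G$ and $X_j=\{j\}$ if $2j=0$ in $G$; $|X_j|\in\{1,2\}$ is its cardinality. The sets $X_0,\ldots,X_N$ partition $G$. For $0\le i,j,k\le N$, $c_{ijk}$ denotes the number of distinct solutions $(x,y)\in X_i\times X_j$ to $x+y=z$ in $G$, where $z\in X_k$ is fixed; this number does not depend on the choice of $z\in X_k$. The matrix $U$ is real, symmetric and unitary. A matrix $T$ is diagonalized by $U$ if $U^*TU$ is diagonal. "$T_i$ generates $\mathcal{A}$" means generates it as a unital algebra, i.e. every element of $\mathcal{A}$ is a polynomial in $T_i$ (constant term multiplying the identity). "Most general matrix" means that the matrices diagonalized by $U$ are exactly those of the given form as the parameters range over $\mathbb{C}$. *)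

theory Defs
  imports
    "HOL-Algebra.Elementary_Groups"
    "HOL-Algebra.Subrings"
    "Jordan_Normal_Form.Schur_Decomposition"
begin

(* Z/nZ is integer_mod_group n, with carrier {0..<n} (written multiplicatively, so
   m_inv is negation); this also covers n = 1. *)

definition orbit :: "nat \<Rightarrow> nat \<Rightarrow> int set" where
  "orbit n j = {int j, inv\<^bsub>integer_mod_group n\<^esub> (int j)}"

definition solutions :: "nat \<Rightarrow> nat \<Rightarrow> nat \<Rightarrow> int \<Rightarrow> (int \<times> int) set" where
  "solutions n i j z =
     {(x, y) \<in> orbit n i \<times> orbit n j. x \<otimes>\<^bsub>integer_mod_group n\<^esub> y = z}"

(* The representative k of its orbit is used here; see solutions_card_indep below for
   independence of this choice. *)
definition sol_count :: "nat \<Rightarrow> nat \<Rightarrow> nat \<Rightarrow> nat \<Rightarrow> nat" where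
  "sol_count n i j k = card (solutions n i j (int k))"

lemma orbit_eq: "n > 0 \<Longrightarrow> j \<le> n div 2 \<Longrightarrow> orbit n j = {int j, (- int j) mod int n}"
  unfolding orbit_def
  by (subst inv_integer_mod_group) (auto simp: carrier_integer_mod_group)

lemma orbit_neg:
  assumes "n > 0" "j \<le> n div 2" "x \<in> orbit n j"
  shows "(- x) mod int n \<in> orbit n j" "(- ((- x) mod int n)) mod int n = x"
proof -
  have j: "int j mod int n = int j" using assms by auto
  have dbl: "(- ((- y) mod int n)) mod int n = y mod int n" for y
    using mod_minus_eq[of "- y" "int n"] by simp
  have x: "x = int j \<or> x = (- int j) mod int n"
    using assms(3) unfolding orbit_eq[OF assms(1,2)] by blast
  show "(- x) mod int n \<in> orbit n j"
    using x
  proof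
    assume "x = (- int j) mod int n"
    hence "(- x) mod int n = int j" by (simp only: dbl j)
    thus ?thesis unfolding orbit_eq[OF assms(1,2)] by blast
  qed (simp add: orbit_eq[OF assms(1,2)])
  show "(- ((- x) mod int n)) mod int n = x"
    unfolding dbl using x j by auto
qed

lemma solutions_card_indep:
  assumes "n > 0" "i \<le> n div 2" "j \<le> n div 2" "k \<le> n div 2" "z \<in> orbit n k"
  shows "card (solutions n i j z) = sol_count n i j k"
proof -
  define f where "f = (\<lambda>x. (- x) mod int n)"
  have f_add: "(f x + f y) mod int n = f ((x + y) mod int n)" for x y
  proof -
    have "(f x + f y) mod int n = (- x + - y) mod int n"
      unfolding f_def by (rule mod_add_eq)
    also have "\<dots> = f ((x + y) mod int n)"
      unfolding f_def by (simp add: mod_minus_eq)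
    finally show ?thesis .
  qed
  have f_orbit: "f x \<in> orbit n l" "f (f x) = x" if "l \<le> n div 2" "x \<in> orbit n l" for l x
    unfolding f_def using orbit_neg[OF assms(1) that] by blast+
  have closed: "map_prod f f p \<in> solutions n i j (f w)" if "p \<in> solutions n i j w" for p w
    using that f_orbit(1)[OF assms(2)] f_orbit(1)[OF assms(3)] f_add
    by (cases p) (auto simp: solutions_def)
  have invol: "map_prod f f (map_prod f f p) = p" if "p \<in> solutions n i j w" for p w
    using that f_orbit(2)[OF assms(2)] f_orbit(2)[OF assms(3)]
    by (cases p) (auto simp: solutions_def)
  have k: "f (f (int k)) = int k"
    by (rule f_orbit(2)[OF assms(4)]) (simp add: orbit_def)
  have "bij_betw (map_prod f f) (solutions n i j (int k)) (solutions n i j (f (int k)))"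
  proof (rule bij_betwI[where g = "map_prod f f"])
    show "map_prod f f \<in> solutions n i j (int k) \<rightarrow> solutions n i j (f (int k))"
      using closed by blast
    show "map_prod f f \<in> solutions n i j (f (int k)) \<rightarrow> solutions n i j (int k)"
      using closed[where w = "f (int k)"] unfolding k by blast
  qed (use invol in blast)+
  hence "card (solutions n i j (f (int k))) = sol_count n i j k"
    by (simp add: sol_count_def bij_betw_same_card)
  thus ?thesis
    using assms(5) orbit_eq[OF assms(1,4)] by (auto simp: sol_count_def f_def)
qed

(* All matrices are indexed from 0, so entry (j, k) below is [.]_{j+1,k+1}. *)

definition dct :: "nat \<Rightarrow> complex mat" where
  "dct n = mat (n div 2 + 1) (n div 2 + 1) (\<lambda>(j, k).
     complex_of_real (sqrt (real (card (orbit n j)) * real (card (orbit n k))) / sqrt (real n)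
       * cos (2 * pi * real j * real k / real n)))"

definition T_mat :: "nat \<Rightarrow> nat \<Rightarrow> complex mat" where
  "T_mat n i = mat (n div 2 + 1) (n div 2 + 1) (\<lambda>(j, k).
     complex_of_real (real (sol_count n i j k) * sqrt (real (card (orbit n k)))
       / sqrt (real (card (orbit n j)))))"

definition D_mat :: "nat \<Rightarrow> nat \<Rightarrow> complex mat" where
  "D_mat n i = of_nat (card (orbit n i)) \<cdot>\<^sub>m
     mat_diag (n div 2 + 1) (\<lambda>k. complex_of_real (cos (2 * pi * real k * real i / real n)))"

definition diagonalized_by :: "complex mat \<Rightarrow> complex mat \<Rightarrow> bool" where
  "diagonalized_by V M \<longleftrightarrow> diagonal_mat (mat_adjoint V * M * V)"

definition dct_algebra :: "nat \<Rightarrow> complex mat set" where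
  "dct_algebra n =
     {M \<in> carrier_mat (n div 2 + 1) (n div 2 + 1). diagonalized_by (dct n) M}"

definition unital_subalgebra :: "nat \<Rightarrow> complex mat set \<Rightarrow> bool" where
  "unital_subalgebra m A \<longleftrightarrow>
     subspace class_ring A (module_mat TYPE(complex) m m) \<and>
     subring A (ring_mat TYPE(complex) m ())"

definition poly_mat :: "nat \<Rightarrow> complex poly \<Rightarrow> complex mat \<Rightarrow> complex mat" where
  "poly_mat m p M =
     (\<Oplus>\<^bsub>ring_mat TYPE(complex) m ()\<^esub> i \<in> {..degree p}. coeff p i \<cdot>\<^sub>m (M ^\<^sub>m i))"

definition generates :: "nat \<Rightarrow> complex mat \<Rightarrow> complex mat set \<Rightarrow> bool" where
  "generates m M A \<longleftrightarrow> A = {poly_mat m p M | p. True}"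

(* Here j, k are the 1-based indices.  The three cases overlap (e.g. at j = 1, k = n/2 + 1);
   each formula is required wherever its case applies.  In the first case j + k < n + 2, and
   the last case forces n to be even, so no natural-number subtraction truncates. *)
definition general_form :: "nat \<Rightarrow> (nat \<Rightarrow> complex) \<Rightarrow> complex mat \<Rightarrow> bool" where
  "general_form n t M \<longleftrightarrow>
     M \<in> carrier_mat (n div 2 + 1) (n div 2 + 1) \<and>
     (\<forall>j \<in> {1..n div 2 + 1}. \<forall>k \<in> {1..n div 2 + 1}.
       (1 < j \<and> real j < real n / 2 + 1 \<and> 1 < k \<and> real k < real n / 2 + 1 \<longrightarrow>
          M $$ (j - 1, k - 1) =
            t (let d = nat \<bar>int k - int j\<bar> in min (n - d) d)
            + t (min (n + 2 - k - j) (k + j - 2))) \<and>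
       (j = 1 \<or> k = 1 \<longrightarrow>
          M $$ (j - 1, k - 1) =
            complex_of_real (sqrt (real (card (orbit n (j - 1)))) * sqrt (real (card (orbit n (k - 1)))))
            * t (max (j - 1) (k - 1))) \<and>
       (real j = real n / 2 + 1 \<or> real k = real n / 2 + 1 \<longrightarrow>
          M $$ (j - 1, k - 1) =
            complex_of_real (sqrt (real (card (orbit n (n div 2 + 1 - j))))
              * sqrt (real (card (orbit n (n div 2 + 1 - k)))))
            * t (max (n div 2 + 1 - j) (n div 2 + 1 - k))))"

end

theory Submission
  imports Defs
begin

text \<open>
  Let $s_j = |X_j|^{1/2}$ and write $[x]$ for the representative of $\pm x$ in
  $\{0, \ldots, N\}$. The matrix $M_t = \sum_i t_i T_i$ has the entries
  $s_j s_k (t_{[k-j]} + t_{[k+j]}) / 2$, which is symmetric in $j, k$ and agrees with the displayed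
  general form case by case. A sum over $k \le N$ weighted by $|X_k|$ of an even function is a sum over
  the whole group, so translation invariance and the product formula for cosines give
  $M_t U = U \mathrm{diag}(\lambda(t))$ with $\lambda_l(t) = \sum_k |X_k| t_k \cos(2 \pi k l / n)$.
  As $\lambda$ is, up to diagonal rescalings, multiplication by $U$, and $U^2 = I$, every diagonal
  matrix occurs, and the first row of $M_t$ determines $t$; hence the $T_i$ are a basis. Finally
  $T_i$ generates iff its eigenvalues are distinct (Lagrange interpolation), that is, iff
  $k \mapsto \pm i k$ is injective on orbits.
\<close>

subsection \<open>Orbit representatives\<close>

text \<open>The representative of $\pm x$ in $\{0, \ldots, \lfloor n/2\rfloor\}$.\<close>

definition rep :: "nat \<Rightarrow> int \<Rightarrow> nat" where
  "rep n x = nat (min (x mod int n) ((- x) mod int n))"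

lemma neg_mod_eq: "(- x) mod int n = (if x mod int n = 0 then 0 else int n - x mod int n)"
  by (simp add: zmod_zminus1_eq_if)

lemma int_rep: "n > 0 \<Longrightarrow> int (rep n x) = x mod int n \<or> int (rep n x) = (- x) mod int n"
  by (auto simp: rep_def min_def)

lemma rep_mod [simp]: "rep n (x mod int n) = rep n x"
  by (simp add: rep_def mod_minus_eq)

lemma rep_minus [simp]: "rep n (- x) = rep n x"
  by (simp add: rep_def min.commute)

lemma rep_le:
  assumes "n > 0"
  shows "rep n x \<le> n div 2"
proof -
  have "0 \<le> x mod int n" "x mod int n < int n"
    using assms by auto
  thus ?thesis
    unfolding rep_def neg_mod_eq by auto
qed

lemma rep_of_nat:
  assumes "n > 0" "j \<le> n div 2"
  shows "rep n (int j) = j"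
proof -
  have "int j mod int n = int j"
    using assms by auto
  thus ?thesis
    using assms unfolding rep_def neg_mod_eq by auto
qed

text \<open>A representative is the residue of x or of -x, so equality of representatives leaves
  four sign combinations, which collapse to the two divisibilities.\<close>

lemma rep_eq_iff:
  assumes "n > 0"
  shows "rep n x = rep n y \<longleftrightarrow> int n dvd x - y \<or> int n dvd x + y"
proof
  assume "rep n x = rep n y"
  hence "int (rep n x) = int (rep n y)" by simp
  then consider "x mod int n = y mod int n" | "x mod int n = (- y) mod int n"
    | "(- x) mod int n = y mod int n" | "(- x) mod int n = (- y) mod int n"
    using int_rep[OF assms, of x] int_rep[OF assms, of y] by metis
  thus "int n dvd x - y \<or> int n dvd x + y"
    by cases (auto simp: mod_eq_dvd_iff dvd_diff_commute minus_diff_commute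
        add.commute dest: dvd_minus_iff[THEN iffD2])
next
  assume "int n dvd x - y \<or> int n dvd x + y"
  thus "rep n x = rep n y"
  proof
    assume "int n dvd x - y"
    hence "x mod int n = y mod int n" "(- x) mod int n = (- y) mod int n"
      by (auto simp: mod_eq_dvd_iff dvd_diff_commute)
    thus ?thesis by (simp add: rep_def)
  next
    assume "int n dvd x + y"
    hence "x mod int n = (- y) mod int n" "(- x) mod int n = y mod int n"
      using dvd_minus_iff[of "int n" "x + y"] by (auto simp: mod_eq_dvd_iff)
    thus ?thesis by (simp add: rep_def min.commute)
  qed
qed

text \<open>Negation modulo n is an involution, so the orbits are the fibres of \<open>rep\<close>
  on the residues. This exhibits them as a partition of the group.\<close>

lemma mem_orbit_iff:
  assumes "n > 0" "j \<le> n div 2"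
  shows "x \<in> orbit n j \<longleftrightarrow> x \<in> {0..<int n} \<and> rep n x = j"
proof
  assume "x \<in> orbit n j"
  hence x: "x = int j \<or> x = (- int j) mod int n"
    by (simp add: orbit_eq[OF assms])
  hence "rep n x = j"
    using rep_of_nat[OF assms] by auto
  moreover have "int j < int n"
    using assms by simp
  hence "0 \<le> x \<and> x < int n"
    using x assms(1) by (elim disjE) simp_all
  ultimately show "x \<in> {0..<int n} \<and> rep n x = j"
    by simp
next
  assume "x \<in> {0..<int n} \<and> rep n x = j"
  hence x: "x mod int n = x" and j: "rep n x = j" by auto
  hence "int j = x \<or> int j = (- x) mod int n"
    using int_rep[OF assms(1), of x] by auto
  moreover have "(- ((- x) mod int n)) mod int n = x"
    using mod_minus_eq[of "- x" "int n"] x by simp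
  ultimately show "x \<in> orbit n j"
    unfolding orbit_eq[OF assms] by auto
qed

lemma card_orbit:
  assumes "n > 0" "j \<le> n div 2"
  shows "card (orbit n j) = (if j = 0 \<or> 2 * j = n then 1 else 2)"
proof -
  have "int j mod int n = int j"
    using assms by auto
  hence "(- int j) mod int n = (if j = 0 then 0 else int n - int j)"
    by (simp add: neg_mod_eq)
  thus ?thesis
    using assms unfolding orbit_eq[OF assms] by (auto simp: card_insert_if)
qed

section \<open>Weighted sums over representatives as sums over the group\<close>

lemma sum_rep:
  fixes g :: "nat \<Rightarrow> 'a :: comm_semiring_1"
  assumes "n > 0"
  shows "(\<Sum>x\<in>{0..<int n}. g (rep n x)) = (\<Sum>k\<le>n div 2. of_nat (card (orbit n k)) * g k)"
proof -
  have "(\<Sum>x\<in>{0..<int n}. g (rep n x)) =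
      (\<Sum>k\<le>n div 2. \<Sum>x\<in>{x \<in> {0..<int n}. rep n x = k}. g (rep n x))"
    by (rule sum.group[symmetric]) (auto intro: rep_le[OF assms])
  also have "\<dots> = (\<Sum>k\<le>n div 2. \<Sum>x\<in>orbit n k. g k)"
    by (intro sum.cong) (auto simp: mem_orbit_iff[OF assms])
  finally show ?thesis by simp
qed

text \<open>An even function of period n takes the same value at x and at its representative, so
  \<open>sum_rep\<close> applies. The gain is a sum over the whole group, where translations are
  available.\<close>

lemma sum_even_periodic:
  fixes h :: "int \<Rightarrow> 'a :: comm_semiring_1"
  assumes "n > 0" "\<And>x. h (x mod int n) = h x" "\<And>x. h (- x) = h x"
  shows "(\<Sum>k\<le>n div 2. of_nat (card (orbit n k)) * h (int k)) = (\<Sum>x\<in>{0..<int n}. h x)"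
proof -
  have "h (int (rep n x)) = h x" for x
    using int_rep[OF assms(1), of x] assms(2,3) by metis
  thus ?thesis
    using sum_rep[OF assms(1), of "\<lambda>k. h (int k)"] by simp
qed

lemma sum_periodic_shift:
  fixes h :: "int \<Rightarrow> 'a :: comm_monoid_add"
  assumes "n > 0" "\<And>x. h (x mod int n) = h x"
  shows "(\<Sum>x\<in>{0..<int n}. h (x + a)) = (\<Sum>x\<in>{0..<int n}. h x)"
proof (rule sum.reindex_bij_witness[where i = "\<lambda>x. (x - a) mod int n" and j = "\<lambda>x. (x + a) mod int n"])
  fix x assume "x \<in> {0..<int n}"
  thus "((x + a) mod int n - a) mod int n = x" "((x - a) mod int n + a) mod int n = x"
    by (auto simp: mod_diff_left_eq mod_add_left_eq)
qed (use assms in auto)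

text \<open>Doubling avoids a case split: if j = -j in the group, the orbit has one point and the
  two values on the right coincide; otherwise they are the values at the two points of the
  orbit.\<close>

lemma sum_orbit:
  fixes h :: "int \<Rightarrow> 'a :: comm_semiring_1"
  assumes "n > 0" "j \<le> n div 2" "\<And>x. h (x mod int n) = h x"
  shows "2 * (\<Sum>y\<in>orbit n j. h y) = of_nat (card (orbit n j)) * (h (int j) + h (- int j))"
proof -
  have "h ((- int j) mod int n) = h (- int j)" by (rule assms(3))
  thus ?thesis
    unfolding orbit_eq[OF assms(1,2)]
    by (cases "int j = (- int j) mod int n") (simp_all add: algebra_simps mult_2)
qed

text \<open>A solution is determined by its second component y, since x = k - y. It remains to count
  the y in the orbit of j for which k - y has representative i, and \<open>sum_orbit\<close>
  evaluates this count.\<close>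

lemma sol_count_eq:
  assumes "n > 0" "i \<le> n div 2" "j \<le> n div 2" "k \<le> n div 2"
  shows "2 * sol_count n i j k =
    card (orbit n j) * (of_bool (rep n (int k - int j) = i) + of_bool (rep n (int k + int j) = i))"
proof -
  have k: "int k mod int n = int k"
    using assms by auto
  have "bij_betw snd (solutions n i j (int k)) {y \<in> orbit n j. rep n (int k - y) = i}"
  proof (rule bij_betwI[where g = "\<lambda>y. ((int k - y) mod int n, y)"])
    have *: "x = (int k - y) mod int n" if "(x + y) mod int n = int k" "x \<in> orbit n i" for x y
    proof -
      have "(int k - y) mod int n = ((x + y) mod int n - y) mod int n"
        using that(1) by simp
      also have "\<dots> = x mod int n"
        by (simp add: mod_diff_left_eq)
      also have "\<dots> = x"
        using that(2) mem_orbit_iff[OF assms(1,2), of x] by auto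
      finally show ?thesis by simp
    qed
    show "snd \<in> solutions n i j (int k) \<rightarrow> {y \<in> orbit n j. rep n (int k - y) = i}"
      using * mem_orbit_iff[OF assms(1,2)] by (fastforce simp: solutions_def)
    show "(\<lambda>y. ((int k - y) mod int n, y)) \<in> {y \<in> orbit n j. rep n (int k - y) = i} \<rightarrow> solutions n i j (int k)"
      using assms(1) k by (auto simp: solutions_def mem_orbit_iff[OF assms(1,2)] mod_add_left_eq)
    show "((int k - snd p) mod int n, snd p) = p" if "p \<in> solutions n i j (int k)" for p
      using that * by (auto simp: solutions_def)
  qed simp
  hence "sol_count n i j k = card {y \<in> orbit n j. rep n (int k - y) = i}"
    by (simp add: sol_count_def bij_betw_same_card)
  also have "\<dots> = (\<Sum>y\<in>orbit n j. of_bool (rep n (int k - y) = i))"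
    by (simp add: orbit_def card_eq_sum sum.inter_filter[symmetric] of_bool_def del: sum_constant)
  finally have "2 * sol_count n i j k = 2 * (\<Sum>y\<in>orbit n j. of_bool (rep n (int k - y) = i))"
    by simp
  also have "\<dots> = card (orbit n j) *
      (of_bool (rep n (int k - int j) = i) + of_bool (rep n (int k - (- int j)) = i))"
  proof -
    have "rep n (int k - y mod int n) = rep n (int k - y)" for y
      using rep_mod[of n "int k - y mod int n"] rep_mod[of n "int k - y"]
      by (simp only: mod_diff_right_eq)
    thus ?thesis
      by (subst sum_orbit[OF assms(1,3)]) simp_all
  qed
  finally show ?thesis
    by simp
qed

subsection \<open>Cosines\<close>

definition gcos :: "nat \<Rightarrow> int \<Rightarrow> real" where
  "gcos n x = cos (2 * pi * real_of_int x / real n)"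

lemma gcos_minus [simp]: "gcos n (- x) = gcos n x"
  by (simp add: gcos_def)

lemma gcos_0 [simp]: "gcos n 0 = 1"
  by (simp add: gcos_def)

lemma gcos_cong:
  assumes "n > 0" "x mod int n = y mod int n"
  shows "gcos n x = gcos n y"
proof -
  obtain q where "x = y + int n * q"
    using assms(2) by (auto simp: mod_eq_dvd_iff dvd_def algebra_simps)
  hence "2 * pi * real_of_int x / real n = 2 * pi * real_of_int y / real n + 2 * pi * real_of_int q"
    using assms(1) by (simp add: field_simps)
  thus ?thesis
    by (simp add: gcos_def cos_add)
qed

lemma gcos_mult: "2 * (gcos n x * gcos n y) = gcos n (x + y) + gcos n (x - y)"
  by (simp add: gcos_def cos_add cos_diff algebra_simps add_divide_distrib diff_divide_distrib)

text \<open>The sum is the real part of a geometric series in an n-th root of unity w. It vanishes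
  unless w = 1, and w = 1 forces n to divide m.\<close>

lemma sum_gcos:
  assumes "n > 0"
  shows "(\<Sum>x\<in>{0..<int n}. gcos n (m * x)) = (if int n dvd m then real n else 0)"
proof (cases "int n dvd m")
  case True
  hence "gcos n (m * x) = gcos n 0" for x
    by (intro gcos_cong[OF assms]) auto
  thus ?thesis using True by simp
next
  case False
  define w where "w = cis (2 * pi * real_of_int m / real n)"
  have "w \<noteq> 1"
  proof
    assume "w = 1"
    hence "cos (2 * pi * real_of_int m / real n) = 1"
      by (metis w_def cis.sel(1) one_complex.sel(1))
    then obtain q :: int where "2 * pi * real_of_int m / real n = real_of_int q * 2 * pi"
      unfolding cos_one_2pi_int by auto
    hence "real_of_int m = real_of_int (q * int n)"
      using assms by (simp add: field_simps)
    hence "m = q * int n"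
      by (simp only: of_int_eq_iff)
    thus False using False by simp
  qed
  have "w ^ n = cis (2 * pi * real_of_int m)"
    using assms by (simp add: w_def DeMoivre)
  hence "w ^ n = 1" by simp
  hence "(\<Sum>k<n. w ^ k) = 0"
    using \<open>w \<noteq> 1\<close> by (simp add: geometric_sum)
  hence "Re (\<Sum>k<n. w ^ k) = 0" by simp
  moreover have "Re (w ^ k) = gcos n (m * int k)" for k
    by (simp add: w_def DeMoivre gcos_def mult_ac)
  ultimately have "(\<Sum>k<n. gcos n (m * int k)) = 0" by simp
  moreover have "(\<Sum>x\<in>{0..<int n}. gcos n (m * x)) = (\<Sum>k<n. gcos n (m * int k))"
    by (rule sum.reindex_bij_witness[where i = int and j = nat]) auto
  ultimately show ?thesis using False by simp
qed

text \<open>Cosine is injective on [0, pi], and a representative, being at most n/2, gives an angle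
  in that interval.\<close>

lemma gcos_eq_iff:
  assumes "n > 0"
  shows "gcos n x = gcos n y \<longleftrightarrow> rep n x = rep n y"
proof -
  have g: "gcos n z = gcos n (int (rep n z))" for z
    using int_rep[OF assms, of z] gcos_cong[OF assms, of "int (rep n z)" z]
      gcos_cong[OF assms, of "int (rep n z)" "- z"] by fastforce
  have b: "0 \<le> 2 * pi * real_of_int (int (rep n z)) / real n"
    "2 * pi * real_of_int (int (rep n z)) / real n \<le> pi" for z
  proof -
    have "2 * rep n z \<le> n" using rep_le[OF assms, of z] by simp
    hence "2 * real (rep n z) \<le> real n" by linarith
    thus "2 * pi * real_of_int (int (rep n z)) / real n \<le> pi"
      using assms by (simp add: field_simps)
  qed simp
  show ?thesis
    using cos_inj_pi[OF b b, of x y] assms g[of x] g[of y] by (auto simp: gcos_def)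
qed

subsection \<open>The transform\<close>

lemma gcos_mod: "n > 0 \<Longrightarrow> gcos n ((x mod int n) * l) = gcos n (x * l)"
  by (rule gcos_cong) (simp_all add: mod_mult_left_eq)

lemma gcos_mod_add:
  assumes "n > 0"
  shows "gcos n ((x mod int n + y) * l) = gcos n ((x + y) * l)"
proof (rule gcos_cong[OF assms])
  show "(x mod int n + y) * l mod int n = (x + y) * l mod int n"
    by (metis mod_add_left_eq mod_mult_left_eq)
qed

text \<open>The normalizing factor s_j of the overview, complex because it occurs as a factor of
  complex matrix entries.\<close>

definition wt :: "nat \<Rightarrow> nat \<Rightarrow> complex" where
  "wt n j = complex_of_real (sqrt (real (card (orbit n j))))"

lemma wt_mult_self: "wt n j * wt n j = of_nat (card (orbit n j))"
  unfolding wt_def of_real_mult[symmetric] by simp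

lemma wt_nonzero: "n > 0 \<Longrightarrow> j \<le> n div 2 \<Longrightarrow> wt n j \<noteq> 0"
  by (simp add: wt_def card_orbit)

lemma dct_carrier [simp]: "dct n \<in> carrier_mat (Suc (n div 2)) (Suc (n div 2))"
  by (simp add: dct_def)

lemma dct_index:
  assumes "j \<le> n div 2" "k \<le> n div 2"
  shows "dct n $$ (j, k) = wt n j * wt n k / of_real (sqrt (real n)) * of_real (gcos n (int j * int k))"
  using assms by (simp add: dct_def wt_def gcos_def real_sqrt_mult mult_ac)

lemma adjoint_dct: "mat_adjoint (dct n) = dct n"
proof (rule eq_matI)
  fix i j assume "i < dim_row (dct n)" "j < dim_col (dct n)"
  hence "i \<le> n div 2" "j \<le> n div 2" by (auto simp: dct_def)
  thus "mat_adjoint (dct n) $$ (i, j) = dct n $$ (i, j)"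
    by (simp add: mat_adjoint_def mat_of_rows_def dct_def mult_ac)
qed (auto simp: mat_adjoint_def dct_def)

lemma mult_index_sum:
  assumes "A \<in> carrier_mat m (Suc p)" "B \<in> carrier_mat (Suc p) q" "i < m" "j < q"
  shows "(A * B) $$ (i, j) = (\<Sum>k\<le>p. A $$ (i, k) * B $$ (k, j))"
  using assms by (simp add: scalar_prod_def atLeast0LessThan lessThan_Suc_atMost)

text \<open>Orthogonality of cosines: the weights |X_k| turn the sum over k into one over the group,
  and the product formula with \<open>sum_gcos\<close> reduces it to the divisibility of j + l and j
  - l by n.\<close>

lemma dct_mult_dct:
  assumes "n > 0"
  shows "dct n * dct n = 1\<^sub>m (Suc (n div 2))"
proof (rule eq_matI)
  fix j l assume "j < dim_row (1\<^sub>m (Suc (n div 2)) :: complex mat)" "l < dim_col (1\<^sub>m (Suc (n div 2)) :: complex mat)"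
  hence jl: "j \<le> n div 2" "l \<le> n div 2" by auto
  have "(dct n * dct n) $$ (j, l) = (\<Sum>k\<le>n div 2. dct n $$ (j, k) * dct n $$ (k, l))"
    using jl by (intro mult_index_sum[where m = "Suc (n div 2)" and q = "Suc (n div 2)"]) simp_all
  also have "\<dots> = (\<Sum>k\<le>n div 2. wt n j * wt n l / of_nat n *
      (of_nat (card (orbit n k)) * of_real (gcos n (int k * int j) * gcos n (int k * int l))))"
  proof (rule sum.cong)
    fix k assume "k \<in> {..n div 2}"
    moreover have "complex_of_real (sqrt (real n)) * of_real (sqrt (real n)) = of_nat n"
      unfolding of_real_mult[symmetric] by simp
    ultimately show "dct n $$ (j, k) * dct n $$ (k, l) = wt n j * wt n l / of_nat n *
      (of_nat (card (orbit n k)) * of_real (gcos n (int k * int j) * gcos n (int k * int l)))"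
      using jl by (simp add: dct_index wt_mult_self[symmetric] mult_ac)
  qed simp
  also have "\<dots> = wt n j * wt n l / of_nat n *
      (\<Sum>x\<in>{0..<int n}. of_real (gcos n (x * int j) * gcos n (x * int l)))"
    unfolding sum_distrib_left[symmetric]
    by (subst sum_even_periodic[OF assms]) (simp_all add: gcos_mod[OF assms])
  also have "(\<Sum>x\<in>{0..<int n}. of_real (gcos n (x * int j) * gcos n (x * int l))) =
      complex_of_real ((\<Sum>x\<in>{0..<int n}. gcos n ((int j + int l) * x) + gcos n ((int j - int l) * x)) / 2)"
    unfolding of_real_sum[symmetric] sum_divide_distrib
  proof (intro arg_cong[where f = of_real] sum.cong)
    fix x
    show "gcos n (x * int j) * gcos n (x * int l) =
        (gcos n ((int j + int l) * x) + gcos n ((int j - int l) * x)) / 2"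
      using gcos_mult[of n "x * int j" "x * int l"] by (simp add: algebra_simps)
  qed simp
  also have "\<dots> = complex_of_real (((if int n dvd int j + int l then real n else 0) +
      (if int n dvd int j - int l then real n else 0)) / 2)"
    by (simp add: sum.distrib sum_gcos[OF assms])
  also have "wt n j * wt n l / of_nat n * \<dots> = (if j = l then 1 else 0)"
  proof (cases "j = l")
    case True
    \<comment> \<open>On the diagonal, n divides 2j exactly when j = -j in the group. The bracket is
      therefore n if |X_j| = 1 and n/2 if |X_j| = 2, which the factor |X_j|/n turns into 1 in both
      cases.\<close>
    have "int n dvd int j + int j \<longleftrightarrow> card (orbit n j) = 1"
    proof -
      have "int n dvd int j + int j \<longleftrightarrow> n dvd 2 * j"
        by (metis int_dvd_int_iff mult_2 of_nat_add)
      also have "\<dots> \<longleftrightarrow> j = 0 \<or> 2 * j = n"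
      proof
        assume "n dvd 2 * j"
        then obtain q where q: "2 * j = n * q" by (rule dvdE)
        hence "n * q \<le> n * 1" using jl by linarith
        hence "q \<le> 1" using assms by simp
        hence "q = 0 \<or> q = 1" by auto
        thus "j = 0 \<or> 2 * j = n" using q by auto
      qed auto
      finally show ?thesis
        using jl by (simp add: card_orbit[OF assms])
    qed
    moreover have "card (orbit n j) = 1 \<or> card (orbit n j) = 2"
      using jl by (simp add: card_orbit[OF assms])
    ultimately show ?thesis
      using assms True by (auto simp: wt_mult_self)
  next
    case False
    \<comment> \<open>Distinct indices up to n/2 satisfy 0 < j + l < n and 0 < |j - l| < n.\<close>
    have "\<not> int n dvd int j + int l"
      using jl False assms by (intro zdvd_not_zless) auto
    moreover have "\<not> int n dvd int j - int l"
    proof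
      assume "int n dvd int j - int l"
      hence "int n \<le> \<bar>int j - int l\<bar>"
        using False dvd_imp_le_int[of "int j - int l" "int n"] by simp
      thus False using jl assms by linarith
    qed
    ultimately show ?thesis using False by simp
  qed
  finally show "(dct n * dct n) $$ (j, l) = 1\<^sub>m (Suc (n div 2)) $$ (j, l)"
    using jl by simp
qed (auto simp: dct_def)

text \<open>The eigenvalues of $\sum_k t_k T_k$.\<close>

definition eig :: "nat \<Rightarrow> (nat \<Rightarrow> complex) \<Rightarrow> nat \<Rightarrow> complex" where
  "eig n t l = (\<Sum>k\<le>n div 2. of_nat (card (orbit n k)) * (t k * of_real (gcos n (int k * int l))))"

text \<open>
  The entries of $\sum_i t_i T_i$: since $c_{ijk}$ counts the $y \in X_j$ with $k - y \in X_i$,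
  averaging over $y = \pm j$ gives $2 c_{ijk} = |X_j| ([k - j \in X_i] + [k + j \in X_i])$, with no
  case distinction on whether $j = -j$.
\<close>

definition gen_mat :: "nat \<Rightarrow> (nat \<Rightarrow> complex) \<Rightarrow> complex mat" where
  "gen_mat n t = mat (Suc (n div 2)) (Suc (n div 2)) (\<lambda>(j, k).
     wt n j * wt n k * (t (rep n (int k - int j)) + t (rep n (int k + int j))) / 2)"

lemma gen_mat_carrier [simp]: "gen_mat n t \<in> carrier_mat (Suc (n div 2)) (Suc (n div 2))"
  by (simp add: gen_mat_def)

lemma gen_mat_index:
  "j \<le> n div 2 \<Longrightarrow> k \<le> n div 2 \<Longrightarrow> gen_mat n t $$ (j, k) =
    wt n j * wt n k * (t (rep n (int k - int j)) + t (rep n (int k + int j))) / 2"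
  by (simp add: gen_mat_def)

lemma rep_mod_add: "rep n (x mod int n + y) = rep n (x + y)"
  by (metis mod_add_left_eq rep_mod)

text \<open>Both factors are even and periodic, so \<open>eig\<close> is the discrete Fourier
  transform of the even function on the group that t induces through \<open>rep\<close>.\<close>

lemma eig_eq_sum:
  assumes "n > 0"
  shows "eig n t l = (\<Sum>x\<in>{0..<int n}. t (rep n x) * of_real (gcos n (x * int l)))"
proof -
  have "eig n t l = (\<Sum>k\<le>n div 2. of_nat (card (orbit n k)) * 
      (t (rep n (int k)) * of_real (gcos n (int k * int l))))"
    unfolding eig_def by (intro sum.cong) (simp_all add: rep_of_nat[OF assms])
  thus ?thesis
    by (subst (asm) sum_even_periodic[OF assms]) (simp_all add: gcos_mod[OF assms])
qed

text \<open>The columns of U are common eigenvectors. Once the product is a sum over the group,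
  translating by j or -j moves the shift from t into the cosine, and the product formula splits off
  the factor depending on j.\<close>

lemma gen_mat_mult_dct:
  assumes "n > 0"
  shows "gen_mat n t * dct n = dct n * mat_diag (Suc (n div 2)) (eig n t)"
proof (rule eq_matI)
  fix j l assume "j < dim_row (dct n * mat_diag (Suc (n div 2)) (eig n t))"
    "l < dim_col (dct n * mat_diag (Suc (n div 2)) (eig n t))"
  hence jl: "j \<le> n div 2" "l \<le> n div 2" by (auto simp: dct_def mat_diag_def)
  define c where "c = wt n j * wt n l / of_real (sqrt (real n))"
  \<comment> \<open>\<open>h\<close> is the summand as a function on the group. Negation swaps its
    two shifted terms, so it is even although neither term need be. \<open>g\<close> is the summand
    of the eigenvalue, and \<open>f a\<close> has the shift a in the cosine instead of in t.\<close>
  define h where "h = (\<lambda>x. (t (rep n (x - int j)) + t (rep n (x + int j))) * of_real (gcos n (x * int l)))"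
  define g where "g = (\<lambda>x. t (rep n x) * complex_of_real (gcos n (x * int l)))"
  define f where "f = (\<lambda>a x. t (rep n x) * complex_of_real (gcos n ((x + a) * int l)))"
  have f_mod: "f a (x mod int n) = f a x" for a x
    by (simp add: f_def gcos_mod_add[OF assms])
  have h_neg: "h (- x) = h x" for x
  proof -
    have "rep n (- x - int j) = rep n (x + int j)" "rep n (- x + int j) = rep n (x - int j)"
      using rep_minus[of n "x + int j"] rep_minus[of n "x - int j"] by simp_all
    thus ?thesis by (simp add: h_def add.commute)
  qed
  have h_mod: "h (x mod int n) = h x" for x
    using rep_mod_add[of n x "int j"] rep_mod_add[of n x "- int j"] gcos_mod[OF assms]
    by (simp add: h_def)
  have "(gen_mat n t * dct n) $$ (j, l) = (\<Sum>k\<le>n div 2. gen_mat n t $$ (j, k) * dct n $$ (k, l))"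
    using jl by (intro mult_index_sum[where m = "Suc (n div 2)" and q = "Suc (n div 2)"]) simp_all
  also have "\<dots> = (\<Sum>k\<le>n div 2. c / 2 * (of_nat (card (orbit n k)) * h (int k)))"
    using jl by (intro sum.cong)
      (simp_all add: gen_mat_index dct_index c_def h_def wt_mult_self[symmetric] mult_ac)
  also have "\<dots> = c / 2 * (\<Sum>x\<in>{0..<int n}. h x)"
    unfolding sum_distrib_left[symmetric]
    by (subst sum_even_periodic[OF assms]) (simp_all add: h_neg h_mod)
  \<comment> \<open>Each half of \<open>h\<close> is a translate of some \<open>f a\<close>, with a
    opposite to the translation so that the cosine still sees x.\<close>
  also have "(\<Sum>x\<in>{0..<int n}. h x) =
      (\<Sum>x\<in>{0..<int n}. f (int j) (x - int j)) + (\<Sum>x\<in>{0..<int n}. f (- int j) (x + int j))"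
    unfolding sum.distrib[symmetric] h_def f_def diff_add_cancel
    by (simp only: distrib_right add_uminus_conv_diff add_diff_cancel)
  also have "(\<Sum>x\<in>{0..<int n}. f (int j) (x - int j)) = (\<Sum>x\<in>{0..<int n}. f (int j) x)"
    using sum_periodic_shift[where h = "f (int j)", OF assms f_mod, of "- int j"] by simp
  also have "(\<Sum>x\<in>{0..<int n}. f (- int j) (x + int j)) = (\<Sum>x\<in>{0..<int n}. f (- int j) x)"
    using sum_periodic_shift[where h = "f (- int j)", OF assms f_mod, of "int j"] by simp
  also have "(\<Sum>x\<in>{0..<int n}. f (int j) x) + (\<Sum>x\<in>{0..<int n}. f (- int j) x) =
      (\<Sum>x\<in>{0..<int n}. 2 * of_real (gcos n (int j * int l)) * g x)"
    unfolding sum.distrib[symmetric]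
  proof (rule sum.cong)
    fix x
    have "complex_of_real (2 * (gcos n (x * int l) * gcos n (int j * int l))) =
        of_real (gcos n ((x + int j) * int l)) + of_real (gcos n ((x - int j) * int l))"
      unfolding gcos_mult by (simp add: algebra_simps)
    moreover have "f (int j) x + f (- int j) x = t (rep n x) *
        (of_real (gcos n ((x + int j) * int l)) + of_real (gcos n ((x - int j) * int l)))"
      by (simp add: f_def distrib_left)
    ultimately have "f (int j) x + f (- int j) x =
        t (rep n x) * of_real (2 * (gcos n (x * int l) * gcos n (int j * int l)))"
      by simp
    thus "f (int j) x + f (- int j) x = 2 * of_real (gcos n (int j * int l)) * g x"
      by (simp add: g_def)
  qed simp
  also have "\<dots> = 2 * of_real (gcos n (int j * int l)) * eig n t l"
    by (simp add: eig_eq_sum[OF assms] g_def sum_distrib_left)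
  also have "c / 2 * \<dots> = dct n $$ (j, l) * eig n t l"
    using jl by (simp add: c_def dct_index mult_ac)
  also have "\<dots> = (dct n * mat_diag (Suc (n div 2)) (eig n t)) $$ (j, l)"
    using jl by (simp add: mat_diag_mult_right[of _ "Suc (n div 2)"])
  finally show "(gen_mat n t * dct n) $$ (j, l) = (dct n * mat_diag (Suc (n div 2)) (eig n t)) $$ (j, l)" .
qed (auto simp: dct_def gen_mat_def mat_diag_def)

text \<open>Conjugation of a diagonal matrix by U, written without adjoint or inverse since U is its
  own adjoint and inverse. All algebra operations on such matrices act entrywise on
  \<open>d\<close>.\<close>

definition dct_diag :: "nat \<Rightarrow> (nat \<Rightarrow> complex) \<Rightarrow> complex mat" where
  "dct_diag n d = dct n * mat_diag (Suc (n div 2)) d * dct n"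

lemma dct_diag_carrier [simp]: "dct_diag n d \<in> carrier_mat (Suc (n div 2)) (Suc (n div 2))"
  unfolding dct_diag_def by (intro mult_carrier_mat[of _ "Suc (n div 2)" "Suc (n div 2)"]) simp_all

lemma gen_mat_eq_dct_diag:
  assumes "n > 0"
  shows "gen_mat n t = dct_diag n (eig n t)"
proof -
  have "gen_mat n t = gen_mat n t * (dct n * dct n)"
    unfolding dct_mult_dct[OF assms] by (rule right_mult_one_mat[symmetric, OF gen_mat_carrier])
  also have "\<dots> = gen_mat n t * dct n * dct n"
    by (rule assoc_mult_mat[symmetric, OF gen_mat_carrier dct_carrier dct_carrier])
  finally show ?thesis
    by (simp add: gen_mat_mult_dct[OF assms] dct_diag_def)
qed

lemma dct_conj_dct_diag:
  assumes "n > 0" 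
  shows "dct n * dct_diag n d * dct n = mat_diag (Suc (n div 2)) d"
proof -
  let ?m = "Suc (n div 2)"
  note [simp] = mult_carrier_mat[of _ ?m ?m _ ?m] assoc_mult_mat[of _ ?m ?m _ ?m _ ?m]
  have "dct n * dct_diag n d * dct n = (dct n * dct n) * mat_diag ?m d * (dct n * dct n)"
    by (simp add: dct_diag_def)
  thus ?thesis
    by (simp only: dct_mult_dct[OF assms]) (simp add: left_mult_one_mat[of _ ?m ?m] right_mult_one_mat[of _ ?m ?m])
qed

lemma dct_diag_cong: "(\<And>l. l \<le> n div 2 \<Longrightarrow> d l = e l) \<Longrightarrow> dct_diag n d = dct_diag n e"
  unfolding dct_diag_def mat_diag_def
  by (intro arg_cong2[where f = "(*)"] cong_mat) auto

lemma dct_diag_eq_iff: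
  assumes "n > 0"
  shows "dct_diag n d = dct_diag n e \<longleftrightarrow> (\<forall>l\<le>n div 2. d l = e l)"
proof
  assume "dct_diag n d = dct_diag n e"
  hence "mat_diag (Suc (n div 2)) d = mat_diag (Suc (n div 2)) e"
    using dct_conj_dct_diag[OF assms] by metis
  hence eq: "mat_diag (Suc (n div 2)) d $$ (l, l) = mat_diag (Suc (n div 2)) e $$ (l, l)" for l
    by simp
  show "\<forall>l\<le>n div 2. d l = e l"
  proof (intro allI impI)
    fix l assume "l \<le> n div 2"
    thus "d l = e l"
      using eq[of l] by (simp add: mat_diag_def)
  qed
qed (blast intro: dct_diag_cong)

text \<open>U is an involution, so U M U = D and M = U D U are equivalent; the parameter d is read
  off the diagonal of U M U.\<close>

lemma dct_algebra_eq:
  assumes "n > 0"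
  shows "dct_algebra n = range (dct_diag n)"
proof (intro equalityI subsetI)
  let ?m = "Suc (n div 2)"
  note [simp] = mult_carrier_mat[of _ ?m ?m _ ?m] assoc_mult_mat[of _ ?m ?m _ ?m _ ?m]
  fix M assume "M \<in> dct_algebra n"
  hence M: "M \<in> carrier_mat ?m ?m" and D: "diagonal_mat (dct n * M * dct n)"
    by (auto simp: dct_algebra_def diagonalized_by_def adjoint_dct)
  define d where "d = (\<lambda>l. (dct n * M * dct n) $$ (l, l))"
  have "dct n * M * dct n = mat_diag ?m d"
  proof (rule eq_matI)
    fix i j assume ij: "i < dim_row (mat_diag ?m d)" "j < dim_col (mat_diag ?m d)"
    have "dct n * M * dct n \<in> carrier_mat ?m ?m"
      using M by (intro mult_carrier_mat[of _ ?m ?m]) simp_all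
    hence "i \<noteq> j \<longrightarrow> (dct n * M * dct n) $$ (i, j) = 0"
      using ij D unfolding diagonal_mat_def mat_diag_def by (metis carrier_matD dim_row_mat(1) dim_col_mat(1))
    thus "(dct n * M * dct n) $$ (i, j) = mat_diag ?m d $$ (i, j)"
      using ij by (auto simp: mat_diag_def d_def)
  qed (use M in \<open>auto simp: mat_diag_def dct_def\<close>)
  hence "dct_diag n d = dct n * (dct n * M * dct n) * dct n"
    by (simp add: dct_diag_def)
  also have "\<dots> = (dct n * dct n) * M * (dct n * dct n)"
    using M by simp
  also have "\<dots> = M"
    using M by (simp only: dct_mult_dct[OF assms]) (simp add: left_mult_one_mat[of _ ?m ?m] right_mult_one_mat[of _ ?m ?m])
  finally show "M \<in> range (dct_diag n)" by blast
next
  fix M assume "M \<in> range (dct_diag n)"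
  then obtain d where "M = dct_diag n d" by blast
  thus "M \<in> dct_algebra n"
    unfolding dct_algebra_def diagonalized_by_def adjoint_dct
    using dct_conj_dct_diag[OF assms, of d] by (auto simp: diagonal_mat_def mat_diag_def simp del: index_mult_mat)
qed

text \<open>Up to diagonal rescalings, \<open>eig\<close> is multiplication by U, and U is its own
  inverse.\<close>

lemma eig_surj:
  assumes "n > 0"
  obtains t where "\<And>l. l \<le> n div 2 \<Longrightarrow> eig n t l = d l"
proof -
  let ?s = "complex_of_real (sqrt (real n))"
  have s: "?s \<noteq> 0" using assms by simp
  \<comment> \<open>Applying U to the vector with entries s_k t_k gives s_l / sqrt n times the
    eigenvalue at l. So the target is scaled by s_l / sqrt n, and \<open>t\<close> is U applied to
    it, divided by s_k.\<close>
  define v where "v = vec (Suc (n div 2)) (\<lambda>l. d l * wt n l / ?s)"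
  define t where "t = (\<lambda>k. (dct n *\<^sub>v v) $ k / wt n k)"
  have "eig n t l = d l" if l: "l \<le> n div 2" for l
  proof -
    have "v = dct n *\<^sub>v (dct n *\<^sub>v v)"
      by (subst assoc_mult_mat_vec[symmetric, of _ "Suc (n div 2)" "Suc (n div 2)" _ "Suc (n div 2)"])
        (simp_all add: dct_mult_dct[OF assms] v_def del: dct_carrier, rule dct_carrier)
    hence "v $ l = (dct n *\<^sub>v (dct n *\<^sub>v v)) $ l" by simp
    also have "\<dots> = (\<Sum>k\<le>n div 2. dct n $$ (l, k) * (dct n *\<^sub>v v) $ k)"
      using l by (simp add: scalar_prod_def atLeast0LessThan lessThan_Suc_atMost dct_def)
    also have "\<dots> = (\<Sum>k\<le>n div 2. wt n l / ?s * 
        (of_nat (card (orbit n k)) * (t k * of_real (gcos n (int k * int l)))))"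
      using l wt_nonzero[OF assms]
      by (intro sum.cong) (simp_all add: dct_index t_def wt_mult_self[symmetric] mult_ac)
    also have "\<dots> = wt n l / ?s * eig n t l"
      by (simp add: eig_def sum_distrib_left)
    finally show ?thesis
      using l s wt_nonzero[OF assms l] by (simp add: v_def)
  qed
  thus ?thesis using that by blast
qed

lemma dct_algebra_eq_gen_mat:
  assumes "n > 0"
  shows "dct_algebra n = range (gen_mat n)"
proof -
  have "dct_diag n d \<in> range (gen_mat n)" for d
  proof -
    obtain t where "\<And>l. l \<le> n div 2 \<Longrightarrow> eig n t l = d l"
      using eig_surj[OF assms] by blast
    hence "dct_diag n d = gen_mat n t"
      unfolding gen_mat_eq_dct_diag[OF assms] by (intro dct_diag_cong) simp
    thus ?thesis by blast
  qed
  thus ?thesis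
    unfolding dct_algebra_eq[OF assms] using gen_mat_eq_dct_diag[OF assms] by auto
qed

subsection \<open>The matrices and their general form\<close>

text \<open>By \<open>sol_count_eq\<close>, c_ijk contains the factor |X_j| = s_j * s_j; dividing by
  s_j leaves the factor s_j s_k. This reveals the symmetry hidden in the definition of T_i.\<close>

lemma T_mat_eq_gen_mat:
  assumes "n > 0" "i \<le> n div 2"
  shows "T_mat n i = gen_mat n (\<lambda>k. of_bool (k = i))"
proof (rule eq_matI)
  fix j k assume "j < dim_row (gen_mat n (\<lambda>k. of_bool (k = i)))" "k < dim_col (gen_mat n (\<lambda>k. of_bool (k = i)))"
  hence jk: "j \<le> n div 2" "k \<le> n div 2" by (auto simp: gen_mat_def)
  define b where "b = of_bool (rep n (int k - int j) = i) + (of_bool (rep n (int k + int j) = i) :: nat)"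
  have "2 * sol_count n i j k = card (orbit n j) * b"
    unfolding b_def by (rule sol_count_eq[OF assms jk])
  hence "2 * of_nat (sol_count n i j k) = wt n j * wt n j * of_nat b"
    unfolding wt_mult_self by (metis of_nat_mult of_nat_numeral)
  moreover have "T_mat n i $$ (j, k) = of_nat (sol_count n i j k) * wt n k / wt n j"
    using jk by (simp add: T_mat_def wt_def)
  hence "2 * T_mat n i $$ (j, k) = 2 * of_nat (sol_count n i j k) * wt n k / wt n j"
    by simp
  ultimately have "2 * T_mat n i $$ (j, k) = wt n j * wt n j * of_nat b * wt n k / wt n j"
    by simp
  hence "2 * T_mat n i $$ (j, k) = wt n j * wt n k * of_nat b"
    using wt_nonzero[OF assms(1) jk(1)] by simp
  thus "T_mat n i $$ (j, k) = gen_mat n (\<lambda>k. of_bool (k = i)) $$ (j, k)"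
    using jk by (simp add: gen_mat_index b_def field_simps)
qed (auto simp: T_mat_def gen_mat_def)

lemma eig_of_bool:
  assumes "i \<le> n div 2"
  shows "eig n (\<lambda>k. of_bool (k = i)) l = of_nat (card (orbit n i)) * of_real (gcos n (int i * int l))"
proof -
  have "eig n (\<lambda>k. of_bool (k = i)) l = 
      (\<Sum>k\<le>n div 2. if k = i then of_nat (card (orbit n i)) * of_real (gcos n (int i * int l)) else 0)"
    unfolding eig_def by (intro sum.cong) auto
  thus ?thesis using assms by simp
qed

lemma T_mat_eq_dct_diag:
  assumes "n > 0" "i \<le> n div 2"
  shows "T_mat n i = dct_diag n (\<lambda>l. of_nat (card (orbit n i)) * of_real (gcos n (int i * int l)))"
  unfolding T_mat_eq_gen_mat[OF assms] gen_mat_eq_dct_diag[OF assms(1)] eig_of_bool[OF assms(2)] ..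

lemma T_mat_diagonalization:
  assumes "n > 0" "i \<le> n div 2"
  shows "T_mat n i = dct n * D_mat n i * mat_adjoint (dct n)"
proof -
  have "D_mat n i = mat_diag (Suc (n div 2)) (\<lambda>l. of_nat (card (orbit n i)) * of_real (gcos n (int i * int l)))"
    by (rule eq_matI) (auto simp: D_mat_def mat_diag_def gcos_def mult_ac)
  thus ?thesis
    by (simp add: T_mat_eq_dct_diag[OF assms] dct_diag_def adjoint_dct)
qed

lemma dct_diag_one: "n > 0 \<Longrightarrow> dct_diag n (\<lambda>_. 1) = 1\<^sub>m (Suc (n div 2))"
  unfolding dct_diag_def mat_diag_one right_mult_one_mat[OF dct_carrier] by (rule dct_mult_dct)

lemma T_mat_0:
  assumes "n > 0"
  shows "T_mat n 0 = 1\<^sub>m (Suc (n div 2))"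
  using T_mat_eq_dct_diag[OF assms, of 0] dct_diag_one[OF assms] card_orbit[OF assms, of 0] by simp

text \<open>Swapping j and k only changes the sign of k - j, which \<open>rep\<close>
  ignores.\<close>

lemma transpose_T_mat:
  assumes "n > 0" "i \<le> n div 2"
  shows "transpose_mat (T_mat n i) = T_mat n i"
proof -
  have "rep n (int k - int j) = rep n (int j - int k)" for j k
    using rep_minus[of n "int j - int k"] by simp
  thus ?thesis
    unfolding T_mat_eq_gen_mat[OF assms] gen_mat_def
    by (intro eq_matI) (auto simp: add.commute mult.commute)
qed

lemma elements_T_mat: "elements_mat (T_mat n i) \<subseteq> \<real>"
  by (auto simp: T_mat_def elements_mat_def)

text \<open>The parameters of both forms are the same t. In the interior s_j s_k = 2 cancels the
  factor 1/2; in the first row, and in the last row for even n, the two representatives coincide and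
  the average is a single parameter. Columns follow by symmetry.\<close>

lemma general_form_gen_mat:
  assumes "n > 0"
  shows "general_form n t (gen_mat n t)"
proof -
  have rep_eq: "rep n x = i" if "i \<le> n div 2" "x = int i \<or> x = - int i \<or> x = int n - int i" for x i
  proof -
    have "rep n x = rep n (int i)"
      using that(2) unfolding rep_eq_iff[OF assms] by auto
    thus ?thesis by (simp add: rep_of_nat[OF assms that(1)])
  qed
  have sq: "complex_of_real (sqrt (real (card (orbit n j))) * sqrt (real (card (orbit n k)))) = wt n j * wt n k" for j k
    by (simp add: wt_def)
  have wt2: "wt n j * wt n k = 2" if "0 < j" "2 * j < n" "0 < k" "2 * k < n" for j k
  proof -
    have "wt n j = complex_of_real (sqrt 2)" "wt n k = complex_of_real (sqrt 2)"
      using that by (simp_all add: wt_def card_orbit[OF assms])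
    thus ?thesis by (simp flip: of_real_mult)
  qed
  have wt1: "wt n 0 = 1"
    by (simp add: wt_def card_orbit[OF assms])
  \<comment> \<open>The reflection of j to n/2 - j exchanges 0 and n/2 and preserves the interior,
    hence the orbit sizes. The last case of the general form uses reflected indices in its
    weights.\<close>
  have wt_refl: "wt n (n div 2 - j) = wt n j" if "even n" "j \<le> n div 2" for j
    using that assms by (auto simp: wt_def card_orbit[OF assms] elim!: evenE)
  have sym: "gen_mat n t $$ (j, k) = gen_mat n t $$ (k, j)" if "j \<le> n div 2" "k \<le> n div 2" for j k
    using that rep_minus[of n "int j - int k"] by (simp add: gen_mat_index add.commute mult.commute)
  have interior: "gen_mat n t $$ (j, k) =
      t (let d = nat \<bar>int (k + 1) - int (j + 1)\<bar> in min (n - d) d) + t (min (n + 2 - (k + 1) - (j + 1)) (k + 1 + (j + 1) - 2))"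
    if "0 < j" "2 * j < n" "0 < k" "2 * k < n" for j k
  proof -
    define d where "d = nat \<bar>int k - int j\<bar>"
    have "rep n (int k - int j) = min (n - d) d"
      using that by (intro rep_eq) (auto simp: d_def min_def)
    \<comment> \<open>Here indices start at 0; the summands 2 and -2 in the displayed form absorb
      the shift of both indices by one.\<close>
    moreover have "rep n (int k + int j) = min (n - (k + j)) (k + j)"
      using that by (intro rep_eq) (auto simp: min_def)
    ultimately show ?thesis
      using that wt2[OF that] by (simp add: gen_mat_index d_def Let_def algebra_simps)
  qed
  have first_row: "gen_mat n t $$ (0, k) = wt n 0 * wt n k * t k" if "k \<le> n div 2" for k
    using that by (simp add: gen_mat_index rep_of_nat[OF assms])
  have last_row: "gen_mat n t $$ (n div 2, k) = wt n 0 * wt n (n div 2 - k) * t (n div 2 - k)"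
    if "even n" "k \<le> n div 2" for k
  proof -
    \<comment> \<open>With i = n/2 - k the two arguments are -i and n - i, so both have
      representative i.\<close>
    have "rep n (int k - int (n div 2)) = n div 2 - k" "rep n (int k + int (n div 2)) = n div 2 - k"
      using that by (intro rep_eq; auto elim!: evenE)+
    thus ?thesis
      using that wt_refl[of "n div 2"] wt_refl[of k] by (simp add: gen_mat_index)
  qed
  show ?thesis
    unfolding general_form_def sq
  proof (intro conjI ballI impI)
    show "gen_mat n t \<in> carrier_mat (n div 2 + 1) (n div 2 + 1)" by simp
  next
    fix j' k' assume "j' \<in> {1..n div 2 + 1}" "k' \<in> {1..n div 2 + 1}"
    then obtain j k where j': "j' = j + 1" "j \<le> n div 2" and k': "k' = k + 1" "k \<le> n div 2"
      by (metis atLeastAtMost_iff add_le_cancel_right le_add_diff_inverse2)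
    {
      assume "1 < j' \<and> real j' < real n / 2 + 1 \<and> 1 < k' \<and> real k' < real n / 2 + 1"
      hence "0 < j" "2 * j < n" "0 < k" "2 * k < n"
        unfolding j' k' by auto
      from interior[OF this]
      show "gen_mat n t $$ (j' - 1, k' - 1) =
            t (let d = nat \<bar>int k' - int j'\<bar> in min (n - d) d) + t (min (n + 2 - k' - j') (k' + j' - 2))"
        unfolding j' k' by simp
    next
      assume "j' = 1 \<or> k' = 1"
      thus "gen_mat n t $$ (j' - 1, k' - 1) = wt n (j' - 1) * wt n (k' - 1) * t (max (j' - 1) (k' - 1))"
        using first_row j'(2) k'(2) sym[of j 0] unfolding j' k' by auto
    next
      assume "real j' = real n / 2 + 1 \<or> real k' = real n / 2 + 1"
      hence "real (2 * j) = real n \<or> real (2 * k) = real n"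
        unfolding j' k' by auto
      hence "2 * j = n \<or> 2 * k = n"
        unfolding of_nat_eq_iff .
      hence "even n \<and> (j = n div 2 \<or> k = n div 2)"
        by auto
      thus "gen_mat n t $$ (j' - 1, k' - 1) = wt n (n div 2 + 1 - j') * wt n (n div 2 + 1 - k') *
          t (max (n div 2 + 1 - j') (n div 2 + 1 - k'))"
        using last_row j'(2) k'(2) sym[of j "n div 2"] unfolding j' k' by auto
    }
  qed
qed

text \<open>The three cases cover all index pairs, so t determines every entry. Together with
  \<open>general_form_gen_mat\<close>, the only matrix of general form with parameters t is
  \<open>gen_mat n t\<close>; in particular, the overlapping cases are consistent.\<close>

lemma general_form_unique:
  assumes "general_form n t A" "general_form n t B"
  shows "A = B"
proof (rule eq_matI)
  have carr: "A \<in> carrier_mat (n div 2 + 1) (n div 2 + 1)" "B \<in> carrier_mat (n div 2 + 1) (n div 2 + 1)"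
    using assms by (simp_all add: general_form_def)
  thus "dim_row A = dim_row B" "dim_col A = dim_col B" by auto
  fix j k assume "j < dim_row B" "k < dim_col B"
  hence jk: "j + 1 \<in> {1..n div 2 + 1}" "k + 1 \<in> {1..n div 2 + 1}"
    using carr by auto
  hence "2 * j \<le> n" "2 * k \<le> n" by auto
  hence "2 * real j \<le> real n" "2 * real k \<le> real n" by linarith+
  hence "real (j + 1) \<le> real n / 2 + 1" "real (k + 1) \<le> real n / 2 + 1"
    by simp_all
  then consider
      "1 < j + 1 \<and> real (j + 1) < real n / 2 + 1 \<and> 1 < k + 1 \<and> real (k + 1) < real n / 2 + 1"
    | "j + 1 = 1 \<or> k + 1 = 1"
    | "real (j + 1) = real n / 2 + 1 \<or> real (k + 1) = real n / 2 + 1"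
    by linarith
  hence "A $$ (j + 1 - 1, k + 1 - 1) = B $$ (j + 1 - 1, k + 1 - 1)"
  proof cases
    case 1
    thus ?thesis
      using assms jk unfolding general_form_def by metis
  next
    case 2
    thus ?thesis
      using assms jk unfolding general_form_def by metis
  next
    case 3
    thus ?thesis
      using assms jk unfolding general_form_def by metis
  qed
  thus "A $$ (j, k) = B $$ (j, k)" by simp
qed

lemma dct_algebra_eq_general_form:
  assumes "n > 0"
  shows "dct_algebra n = {M. \<exists>t. general_form n t M}"
  unfolding dct_algebra_eq_gen_mat[OF assms]
  using general_form_gen_mat[OF assms] general_form_unique by blast

subsection \<open>Algebra structure\<close>

lemma dct_diag_add: "dct_diag n d + dct_diag n e = dct_diag n (\<lambda>l. d l + e l)"
proof -
  let ?m = "Suc (n div 2)"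
  have "mat_diag ?m (\<lambda>l. d l + e l) = mat_diag ?m d + mat_diag ?m e"
    by (rule eq_matI) (auto simp: mat_diag_def)
  thus ?thesis
    by (simp add: dct_diag_def mult_add_distrib_mat[of _ ?m ?m _ ?m] add_mult_distrib_mat[of _ ?m ?m _ _ ?m]
        mult_carrier_mat[of _ ?m ?m _ ?m])
qed

lemma dct_diag_smult: "c \<cdot>\<^sub>m dct_diag n d = dct_diag n (\<lambda>l. c * d l)"
proof -
  let ?m = "Suc (n div 2)"
  have "mat_diag ?m (\<lambda>l. c * d l) = c \<cdot>\<^sub>m mat_diag ?m d"
    by (rule eq_matI) (auto simp: mat_diag_def)
  thus ?thesis
    by (simp add: dct_diag_def mult_smult_distrib[of _ ?m ?m _ ?m] mult_smult_assoc_mat[of _ ?m ?m _ ?m]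
        mult_carrier_mat[of _ ?m ?m _ ?m])
qed

text \<open>The two inner copies of U cancel.\<close>

lemma dct_diag_mult:
  assumes "n > 0"
  shows "dct_diag n d * dct_diag n e = dct_diag n (\<lambda>l. d l * e l)"
proof -
  let ?m = "Suc (n div 2)"
  note [simp] = mult_carrier_mat[of _ ?m ?m _ ?m] assoc_mult_mat[of _ ?m ?m _ ?m _ ?m]
  have "dct_diag n d * dct_diag n e = dct n * (mat_diag ?m d * ((dct n * dct n) * (mat_diag ?m e * dct n)))"
    by (simp add: dct_diag_def)
  also have "\<dots> = dct n * (mat_diag ?m d * mat_diag ?m e) * dct n"
    unfolding dct_mult_dct[OF assms] by (simp add: left_mult_one_mat[of _ ?m ?m] del: mat_diag_diag)
  finally show ?thesis
    by (simp add: dct_diag_def)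
qed

lemma dct_diag_zero: "dct_diag n (\<lambda>_. 0) = 0\<^sub>m (Suc (n div 2)) (Suc (n div 2))"
proof -
  have "dct_diag n (\<lambda>_. 0) = 0 \<cdot>\<^sub>m dct_diag n (\<lambda>_. 0)"
    by (simp add: dct_diag_smult)
  also have "\<dots> = 0\<^sub>m (Suc (n div 2)) (Suc (n div 2))"
    by (rule eq_matI) (auto simp: carrier_matD[OF dct_diag_carrier])
  finally show ?thesis .
qed

lemma dct_diag_pow:
  assumes "n > 0"
  shows "dct_diag n d ^\<^sub>m k = dct_diag n (\<lambda>l. d l ^ k)"
proof (induction k)
  case 0
  thus ?case
    using dct_diag_one[OF assms] carrier_matD(1)[OF dct_diag_carrier, of n d] by simp
next
  case (Suc k)
  thus ?case
    by (simp add: dct_diag_mult[OF assms] mult.commute)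
qed

text \<open>The structure is left general because the sum is needed both in the full matrix ring,
  for polynomials, and in the algebra as a vector space of its own, for linear combinations.\<close>

lemma finsum_dct_diag:
  assumes "abelian_monoid R" "finite I" "\<And>i. i \<in> I \<Longrightarrow> dct_diag n (d i) \<in> carrier R"
    "add R = (+)" "zero R = 0\<^sub>m (Suc (n div 2)) (Suc (n div 2))"
  shows "(\<Oplus>\<^bsub>R\<^esub>i\<in>I. dct_diag n (d i)) = dct_diag n (\<lambda>l. \<Sum>i\<in>I. d i l)"
  using assms(2,3)
proof (induction I rule: finite_induct)
  case empty
  thus ?case
    using assms(5) by (simp add: abelian_monoid.finsum_empty[OF assms(1)] dct_diag_zero)
next
  case (insert i I)
  thus ?case
    by (subst abelian_monoid.finsum_insert[OF assms(1)]) (auto simp: assms(4) dct_diag_add)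
qed

lemma poly_mat_dct_diag:
  assumes "n > 0"
  shows "poly_mat (Suc (n div 2)) p (dct_diag n d) = dct_diag n (\<lambda>l. poly p (d l))"
proof -
  let ?R = "ring_mat TYPE(complex) (Suc (n div 2)) ()"
  interpret ring ?R by (rule ring_mat)
  have "poly_mat (Suc (n div 2)) p (dct_diag n d) =
      (\<Oplus>\<^bsub>?R\<^esub>i\<in>{..degree p}. dct_diag n (\<lambda>l. coeff p i * d l ^ i))"
    by (simp add: poly_mat_def dct_diag_pow[OF assms] dct_diag_smult)
  also have "\<dots> = dct_diag n (\<lambda>l. \<Sum>i\<le>degree p. coeff p i * d l ^ i)"
    by (rule finsum_dct_diag) (auto simp: ring_mat_simps abelian_monoid_axioms)
  finally show ?thesis
    by (simp add: poly_altdef)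
qed

section \<open>Generators of the algebra\<close>

lemma lagrange_interpolation_exists:
  fixes x d :: "'a \<Rightarrow> 'b :: field"
  assumes "finite I" "inj_on x I"
  shows "\<exists>p. \<forall>i\<in>I. poly p (x i) = d i"
proof -
  \<comment> \<open>The Lagrange basis polynomial of node i, scaled to take the value
    \<open>d i\<close> there; injectivity of \<open>x\<close> keeps the denominator nonzero.\<close>
  define L where "L = (\<lambda>i. smult (d i / (\<Prod>j\<in>I - {i}. x i - x j)) (\<Prod>j\<in>I - {i}. [:- x j, 1:]))"
  have L: "poly (L i) (x k) = (if i = k then d i else 0)" if "i \<in> I" "k \<in> I" for i k
  proof (cases "i = k")
    case True
    have "(\<Prod>j\<in>I - {i}. x i - x j) \<noteq> 0"
      using assms that by (auto simp: inj_on_def)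
    thus ?thesis
      using True by (simp add: L_def poly_prod)
  next
    case False
    hence "(\<Prod>j\<in>I - {i}. x k - x j) = 0"
      using assms(1) that by (auto intro!: prod_zero)
    thus ?thesis
      using False by (simp add: L_def poly_prod)
  qed
  have "poly (\<Sum>i\<in>I. L i) (x k) = d k" if "k \<in> I" for k
  proof -
    have "poly (\<Sum>i\<in>I. L i) (x k) = (\<Sum>i\<in>I. if i = k then d i else 0)"
      unfolding poly_sum using that by (intro sum.cong) (auto simp: L)
    thus ?thesis using assms(1) that by simp
  qed
  thus ?thesis by blast
qed

text \<open>A polynomial acts on each eigenvalue separately, so it cannot separate equal ones, while
  distinct eigenvalues can be sent to arbitrary values by interpolation.\<close>

lemma generates_iff_inj_on:
  assumes "n > 0"
  shows "generates (Suc (n div 2)) (dct_diag n d) (dct_algebra n) \<longleftrightarrow> inj_on d {..n div 2}"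
proof
  assume gen: "generates (Suc (n div 2)) (dct_diag n d) (dct_algebra n)"
  show "inj_on d {..n div 2}"
  proof (rule inj_onI)
    fix k l assume kl: "k \<in> {..n div 2}" "l \<in> {..n div 2}" "d k = d l"
    \<comment> \<open>The projection onto the k-th eigenvector separates k from every other
      index.\<close>
    have "dct_diag n (\<lambda>i. of_bool (i = k)) \<in> dct_algebra n"
      unfolding dct_algebra_eq[OF assms] by blast
    then obtain p where "dct_diag n (\<lambda>i. of_bool (i = k)) = dct_diag n (\<lambda>i. poly p (d i))"
      using gen unfolding generates_def poly_mat_dct_diag[OF assms] by blast
    hence "of_bool (i = k) = poly p (d i)" if "i \<le> n div 2" for i
      using that unfolding dct_diag_eq_iff[OF assms] by simp
    hence "of_bool (k = k) = (of_bool (l = k) :: complex)"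
      using kl by (metis atMost_iff)
    thus "k = l" by (simp split: if_splits)
  qed
next
  assume inj: "inj_on d {..n div 2}"
  have "\<exists>p. dct_diag n e = dct_diag n (\<lambda>i. poly p (d i))" for e
    using lagrange_interpolation_exists[OF finite_atMost inj, of e]
    unfolding dct_diag_eq_iff[OF assms] by (metis atMost_iff)
  thus "generates (Suc (n div 2)) (dct_diag n d) (dct_algebra n)"
    unfolding generates_def dct_algebra_eq[OF assms] poly_mat_dct_diag[OF assms] by blast
qed

text \<open>Cosines at ik and il agree iff n divides i(k - l) or i(k + l). If i is coprime to n, the
  factor i cancels and k = l follows.\<close>

lemma inj_on_gcos_iff:
  assumes "n > 0"
  shows "inj_on (\<lambda>l. gcos n (int i * int l)) {..n div 2} \<longleftrightarrow> coprime i n"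
proof
  assume inj: "inj_on (\<lambda>l. gcos n (int i * int l)) {..n div 2}"
  show "coprime i n"
  proof (rule ccontr)
    assume "\<not> coprime i n"
    hence g: "gcd i n \<noteq> 1" by (simp add: coprime_iff_gcd_eq_1)
    have "gcd i n > 0" using assms by simp
    with g have g2: "gcd i n \<ge> 2" by linarith
    \<comment> \<open>This index collides with 0, as il is a multiple of n. It is positive, and at
      most n/2 because the gcd is at least 2.\<close>
    define l where "l = n div gcd i n"
    have "l \<le> n div 2"
      unfolding l_def using g2 by (intro div_le_mono2) auto
    moreover have "l > 0"
      unfolding l_def using assms by (simp add: div_greater_zero_iff dvd_imp_le)
    moreover have "n dvd i * l"
    proof -
      have "i * l = (i div gcd i n) * n"
        unfolding l_def by (metis div_mult_swap dvd_div_mult gcd_dvd1 gcd_dvd2)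
      thus ?thesis by simp
    qed
    hence "gcos n (int i * int l) = gcos n (int i * int 0)"
      by (intro gcos_cong[OF assms]) (simp flip: of_nat_mult of_nat_mod)
    ultimately show False
      using inj_onD[OF inj, of l 0] by simp
  qed
next
  assume cop: "coprime i n"
  show "inj_on (\<lambda>l. gcos n (int i * int l)) {..n div 2}"
  proof (rule inj_onI)
    fix k l assume kl: "k \<in> {..n div 2}" "l \<in> {..n div 2}"
      and "gcos n (int i * int k) = gcos n (int i * int l)"
    hence "int n dvd int i * (int k - int l) \<or> int n dvd int i * (int k + int l)"
      unfolding gcos_eq_iff[OF assms] rep_eq_iff[OF assms] by (simp add: algebra_simps)
    moreover have "coprime (int n) (int i)"
      using cop by (simp add: coprime_commute)
    ultimately have "int n dvd int k - int l \<or> int n dvd int k + int l"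
      by (simp add: coprime_dvd_mult_right_iff)
    hence "rep n (int k) = rep n (int l)"
      unfolding rep_eq_iff[OF assms] .
    thus "k = l"
      using kl by (simp add: rep_of_nat[OF assms])
  qed
qed

lemma generates_T_mat_iff:
  assumes "n > 0" "i \<le> n div 2"
  shows "generates (Suc (n div 2)) (T_mat n i) (dct_algebra n) \<longleftrightarrow> coprime i n"
proof -
  have "card (orbit n i) \<noteq> 0" by (simp add: card_orbit[OF assms])
  hence "inj_on (\<lambda>l. of_nat (card (orbit n i)) * complex_of_real (gcos n (int i * int l))) {..n div 2} \<longleftrightarrow>
      inj_on (\<lambda>l. gcos n (int i * int l)) {..n div 2}"
    by (simp add: inj_on_def)
  thus ?thesis
    unfolding T_mat_eq_dct_diag[OF assms] generates_iff_inj_on[OF assms(1)] inj_on_gcos_iff[OF assms(1)] by simp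
qed

section \<open>Subalgebra structure and the basis\<close>

lemma dct_subspace:
  assumes "n > 0"
  shows "subspace class_ring (dct_algebra n) (module_mat TYPE(complex) (Suc (n div 2)) (Suc (n div 2)))"
proof -
  let ?V = "module_mat TYPE(complex) (Suc (n div 2)) (Suc (n div 2))"
  have vs: "vectorspace class_ring ?V" by (rule matrix_vs)
  have "submodule class_ring (dct_algebra n) ?V"
    using vs unfolding vectorspace_def
    by (intro submodule.intro)
      (auto simp: module_mat_simps dct_algebra_eq[OF assms] dct_diag_add dct_diag_smult dct_diag_zero[symmetric])
  with vs show ?thesis by (simp add: subspace_def)
qed

lemma dct_unital_subalgebra:
  assumes "n > 0"
  shows "unital_subalgebra (Suc (n div 2)) (dct_algebra n)"
proof -
  let ?R = "ring_mat TYPE(complex) (Suc (n div 2)) ()"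
  interpret ring ?R by (rule ring_mat)
  \<comment> \<open>The ring's additive inverse is only given abstractly; uniqueness of inverses
    identifies it with entrywise negation of d.\<close>
  have minus: "\<ominus>\<^bsub>?R\<^esub> dct_diag n d = dct_diag n (\<lambda>l. - d l)" for d
  proof (rule minus_equality)
    show "dct_diag n (\<lambda>l. - d l) \<oplus>\<^bsub>?R\<^esub> dct_diag n d = \<zero>\<^bsub>?R\<^esub>"
      by (simp add: ring_mat_simps dct_diag_add dct_diag_zero)
  qed (simp_all add: ring_mat_simps)
  have "subring (dct_algebra n) ?R"
  proof (rule subringI)
    show "\<one>\<^bsub>?R\<^esub> \<in> dct_algebra n"
      by (simp add: ring_mat_simps dct_algebra_eq[OF assms] flip: dct_diag_one[OF assms])
  qed (auto simp: dct_algebra_eq[OF assms] ring_mat_simps minus dct_diag_add dct_diag_mult[OF assms])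
  thus ?thesis
    using dct_subspace[OF assms] by (simp add: unital_subalgebra_def)
qed

text \<open>The first row has entries s_0 s_k t_k with nonzero weights, so it recovers the
  parameters. Conversely, only parameters up to N are read, since representatives do not exceed
  N.\<close>

lemma gen_mat_eq_iff:
  assumes "n > 0"
  shows "gen_mat n s = gen_mat n t \<longleftrightarrow> (\<forall>k\<le>n div 2. s k = t k)"
proof
  assume eq: "gen_mat n s = gen_mat n t"
  show "\<forall>k\<le>n div 2. s k = t k"
  proof (intro allI impI)
    fix k assume k: "k \<le> n div 2"
    have "gen_mat n u $$ (0, k) = wt n 0 * wt n k * u k" for u
      using k by (simp add: gen_mat_index rep_of_nat[OF assms])
    thus "s k = t k"
      using eq wt_nonzero[OF assms k] wt_nonzero[OF assms, of 0] by (metis le0 mult_cancel_left mult_eq_0_iff)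
  qed
next
  assume "\<forall>k\<le>n div 2. s k = t k"
  thus "gen_mat n s = gen_mat n t"
    unfolding gen_mat_def by (simp add: rep_le[OF assms])
qed

text \<open>The parameters of T_i form the i-th unit vector. Injectivity is needed because the basis
  is a set of matrices, which would conceal repetitions.\<close>

lemma inj_on_T_mat:
  assumes "n > 0"
  shows "inj_on (T_mat n) {0..n div 2}"
proof (rule inj_onI)
  fix i j assume ij: "i \<in> {0..n div 2}" "j \<in> {0..n div 2}" "T_mat n i = T_mat n j"
  hence "gen_mat n (\<lambda>k. of_bool (k = i)) = gen_mat n (\<lambda>k. of_bool (k = j))"
    using T_mat_eq_gen_mat[OF assms] by simp
  hence "of_bool (i = i) = (of_bool (i = j) :: complex)"
    using ij(1) unfolding gen_mat_eq_iff[OF assms] by (metis atLeastAtMost_iff)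
  thus "i = j" by (simp split: if_splits)
qed

lemma finsum_smult_T_mat:
  assumes "n > 0" "abelian_monoid R" "add R = (+)" "zero R = 0\<^sub>m (Suc (n div 2)) (Suc (n div 2))"
    "carrier R = dct_algebra n"
  shows "(\<Oplus>\<^bsub>R\<^esub>i\<in>{0..n div 2}. t i \<cdot>\<^sub>m T_mat n i) = gen_mat n t"
proof -
  let ?d = "\<lambda>i l. t i * (of_nat (card (orbit n i)) * complex_of_real (gcos n (int i * int l)))"
  have "(\<Oplus>\<^bsub>R\<^esub>i\<in>{0..n div 2}. t i \<cdot>\<^sub>m T_mat n i) = (\<Oplus>\<^bsub>R\<^esub>i\<in>{0..n div 2}. dct_diag n (?d i))"
    using assms(5) by (intro abelian_monoid.finsum_cong'[OF assms(2)])
      (auto simp: T_mat_eq_dct_diag[OF assms(1)] dct_diag_smult dct_algebra_eq[OF assms(1)])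
  also have "\<dots> = dct_diag n (\<lambda>l. \<Sum>i\<in>{0..n div 2}. ?d i l)"
    using assms by (intro finsum_dct_diag) (auto simp: dct_algebra_eq[OF assms(1)])
  also have "(\<lambda>l. \<Sum>i\<in>{0..n div 2}. ?d i l) = eig n t"
    by (auto simp: eig_def atLeast0AtMost mult_ac)
  finally show ?thesis
    by (simp add: gen_mat_eq_dct_diag[OF assms(1)])
qed

text \<open>A linear combination is a \<open>gen_mat\<close> whose parameters are its coefficients.
  Existence of coordinates is then \<open>dct_algebra_eq_gen_mat\<close>, and uniqueness is
  \<open>gen_mat_eq_iff\<close>.\<close>

lemma basis_T_mat:
  assumes "n > 0"
  shows "vectorspace.basis class_ring
    ((module_mat TYPE(complex) (Suc (n div 2)) (Suc (n div 2)))\<lparr>carrier := dct_algebra n\<rparr>)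
    (T_mat n ` {0..n div 2})"
proof -
  let ?V = "(module_mat TYPE(complex) (Suc (n div 2)) (Suc (n div 2)))\<lparr>carrier := dct_algebra n\<rparr>"
  let ?B = "T_mat n ` {0..n div 2}"
  interpret W: vectorspace class_ring ?V
    by (rule vectorspace.subspace_is_vs[OF matrix_vs dct_subspace[OF assms]])
  have T: "T_mat n i \<in> dct_algebra n" if "i \<le> n div 2" for i
    using that by (auto simp: T_mat_eq_dct_diag[OF assms] dct_algebra_eq[OF assms])
  have comb: "W.lincomb a ?B = gen_mat n (\<lambda>i. a (T_mat n i))" for a
  proof -
    have "W.lincomb a ?B = (\<Oplus>\<^bsub>?V\<^esub>v\<in>?B. a v \<cdot>\<^sub>m v)"
      by (simp add: W.lincomb_def module_mat_simps)
    also have "\<dots> = (\<Oplus>\<^bsub>?V\<^esub>i\<in>{0..n div 2}. a (T_mat n i) \<cdot>\<^sub>m T_mat n i)"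
      using inj_on_T_mat[OF assms]
      by (intro W.finsum_reindex) (auto simp: T_mat_eq_dct_diag[OF assms] dct_diag_smult dct_algebra_eq[OF assms])
    also have "\<dots> = gen_mat n (\<lambda>i. a (T_mat n i))"
      by (rule finsum_smult_T_mat[OF assms W.abelian_monoid_axioms]) (simp_all add: module_mat_simps)
    finally show ?thesis .
  qed
  have "\<exists>!a. a \<in> ?B \<rightarrow>\<^sub>E carrier class_ring \<and> W.lincomb a ?B = v" if v: "v \<in> carrier ?V" for v
  proof -
    obtain t where t: "v = gen_mat n t"
      using v by (auto simp: dct_algebra_eq_gen_mat[OF assms])
    show ?thesis
    proof (intro ex1I conjI)
      \<comment> \<open>Coefficients are indexed by matrices, so t is carried over along the inverse
        of the map from i to T_i. The restriction makes the function extensional, as uniqueness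
        requires.\<close>
      define a where "a = restrict (\<lambda>M. t (the_inv_into {0..n div 2} (T_mat n) M)) ?B"
      show "a \<in> ?B \<rightarrow>\<^sub>E carrier class_ring"
        by (auto simp: a_def class_ring_simps)
      have a: "a (T_mat n i) = t i" if "i \<le> n div 2" for i
        using that inj_on_T_mat[OF assms] by (simp add: a_def the_inv_into_f_f)
      show "W.lincomb a ?B = v"
        unfolding comb t gen_mat_eq_iff[OF assms] using a by blast
      fix b assume b: "b \<in> ?B \<rightarrow>\<^sub>E carrier class_ring \<and> W.lincomb b ?B = v"
      hence "b (T_mat n i) = t i" if "i \<le> n div 2" for i
        using that unfolding comb t gen_mat_eq_iff[OF assms] by blast
      with a b show "b = a"
        by (intro PiE_ext[of b ?B "\<lambda>_. carrier class_ring" a]) (auto simp: a_def class_ring_simps)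
    qed
  qed
  thus ?thesis
    by (subst W.basis_criterion) (auto intro: T)
qed

theorem theorem9:
  fixes n N :: nat
  assumes "n > 0" and "N = n div 2"
  shows "unital_subalgebra (N + 1) (dct_algebra n) \<and>
    inj_on (T_mat n) {0..N} \<and>
    vectorspace.basis class_ring
           ((module_mat TYPE(complex) (N + 1) (N + 1))\<lparr>carrier := dct_algebra n\<rparr>)
           (T_mat n ` {0..N}) \<and>
    (\<forall>i \<in> {0..N}. elements_mat (T_mat n i) \<subseteq> \<real> \<and> transpose_mat (T_mat n i) = T_mat n i \<and>
           T_mat n i = dct n * D_mat n i * mat_adjoint (dct n)) \<and>
    T_mat n 0 = 1\<^sub>m (N + 1) \<and>
    (\<forall>i \<in> {0..N}. generates (N + 1) (T_mat n i) (dct_algebra n) \<longleftrightarrow> coprime i n) \<and>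
    dct_algebra n = {M. \<exists>t :: nat \<Rightarrow> complex. general_form n t M}"
  unfolding assms(2) Suc_eq_plus1[symmetric]
proof (intro conjI ballI)
  show "unital_subalgebra (Suc (n div 2)) (dct_algebra n)"
    by (rule dct_unital_subalgebra[OF assms(1)])
  show "inj_on (T_mat n) {0..n div 2}"
    by (rule inj_on_T_mat[OF assms(1)])
  show "vectorspace.basis class_ring
    ((module_mat TYPE(complex) (Suc (n div 2)) (Suc (n div 2)))\<lparr>carrier := dct_algebra n\<rparr>)
    (T_mat n ` {0..n div 2})"
    by (rule basis_T_mat[OF assms(1)])
  show "T_mat n 0 = 1\<^sub>m (Suc (n div 2))"
    by (rule T_mat_0[OF assms(1)])
  show "dct_algebra n = {M. \<exists>t :: nat \<Rightarrow> complex. general_form n t M}"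
    by (rule dct_algebra_eq_general_form[OF assms(1)])
  fix i assume "i \<in> {0..n div 2}"
  hence i: "i \<le> n div 2" by simp
  show "elements_mat (T_mat n i) \<subseteq> \<real>"
    by (rule elements_T_mat)
  show "transpose_mat (T_mat n i) = T_mat n i"
    by (rule transpose_T_mat[OF assms(1) i])
  show "T_mat n i = dct n * D_mat n i * mat_adjoint (dct n)"
    by (rule T_mat_diagonalization[OF assms(1) i])
  show "generates (Suc (n div 2)) (T_mat n i) (dct_algebra n) \<longleftrightarrow> coprime i n"
    by (rule generates_T_mat_iff[OF assms(1) i])
qed

end
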